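(* Let $\mathbf{D}=[\mathbf{A}\ \mathbf{B}]$, $\mathbf{D}\in\mathbb{C}^{M\times N}$, be a dictionary in the set $\mathcal{D}(d,a,b)$, i.e., a dictionary with coherence $d$ that is the concatenation of a sub-dictionary $\mathbf{A}$ with coherence $a$ and a sub-dictionary $\mathbf{B}$ with coherence $b$, where $a\le b$. For any vector in $\mathbb{C}^M$ that can be represented as a linear combination of $n_a$ linearly independent columns of $\mathbf{A}$ and, equivalently, as a linear combination of $n_b$ linearly independent columns of $\mathbf{B}$, the following inequality holds: $$n_a n_b\ \ge\ \frac{[1-a(n_a-1)]^+\,[1-b(n_b-1)]^+}{d^2},$$ where $[u]^+=\max\{0,u\}$ for $u\in\mathbb{R}$.
   Context: A dictionary is a set of $N$ elements $\mathbf{d}_1,\ldots,\mathbf{d}_N\in\mathbb{C}^M$ with unit $\ell_2$-norm that span $\mathbb{C}^M$, organized as the columns of a matrix $\mathbf{D}=[\mathbf{d}_1\ \ldots\ \mathbf{d}_N]\in\mathbb{C}^{M\times N}$. The coherence of a matrix with unit-norm columns $\mathbf{d}_i$ is $\max_{i\ne j}|\mathbf{d}_i^H\mathbf{d}_j|$ (where $^H$ denotes conjugate transpose), and it is set to $0$ if there is only one column. $\mathcal{D}(d,a,b)$ denotes the set of dictionaries $\mathbf{D}=[\mathbf{A}\ \mathbf{B}]$ with coherence $d$ that consist of two sub-dictionaries $\mathbf{A}$ and $\mathbf{B}$ (matrices with unit $\ell_2$-norm columns in $\mathbb{C}^M$) with coherence $a$ and $b$, respectively; $\mathbf{A}$ and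 $\mathbf{B}$ need not be orthonormal bases, need not have the same number of elements, and need not span $\mathbb{C}^M$. "Equivalently" in the claim means that the same vector also has the second representation.
   Formalization: The vector is assumed to be nonzero: for the zero vector, represented with zero coefficients and n_a = n_b = 1, the stated inequality would read 1 ≥ 1/d², which fails whenever 0 < d < 1. *)

theory Defs
  imports "HOL-Analysis.Analysis"
begin

text \<open>
  Matrices in \<open>\<complex>\<^sup>M\<^sup>\<times>\<^sup>N\<close> are elements of \<^typ>\<open>complex^'n^'m\<close>, where \<open>CARD('m) = M\<close> and
  \<open>CARD('n) = N\<close>. The norm on \<^typ>\<open>complex^'m\<close> is the \<open>\<ell>\<^sub>2\<close>-norm. The library's inner product on this
  type is only the real part of \<open>x\<^sup>H y\<close>, hence the separate definition below. Linear independence and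
  span over the complex scalars are \<open>vec.independent\<close> and \<open>vec.span\<close>.
\<close>

definition herm_prod :: "complex^'m \<Rightarrow> complex^'m \<Rightarrow> complex" where
  "herm_prod x y = (\<Sum>i\<in>UNIV. cnj (x $ i) * y $ i)"

definition unit_columns :: "complex^'n^'m \<Rightarrow> bool" where
  "unit_columns A \<longleftrightarrow> (\<forall>j. norm (column j A) = 1)"

definition is_dictionary :: "complex^'n^'m \<Rightarrow> bool" where
  "is_dictionary D \<longleftrightarrow> unit_columns D \<and> vec.span (columns D) = UNIV"

definition coherence :: "complex^'n^'m \<Rightarrow> real" where
  "coherence A =
     (if CARD('n) = 1 then 0
      else Max {cmod (herm_prod (column i A) (column j A)) | i j. i \<noteq> j})"

definition hconcat :: "complex^'p^'m \<Rightarrow> complex^'q^'m \<Rightarrow> complex^('p + 'q)^'m" where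
  "hconcat A B = (\<chi> i j. case j of Inl k \<Rightarrow> A $ i $ k | Inr k \<Rightarrow> B $ i $ k)"

definition dictionary_class ::
    "real \<Rightarrow> real \<Rightarrow> real \<Rightarrow> (complex^('p::finite + 'q::finite)^'m) set" where
  "dictionary_class d a b =
     {hconcat A B | (A :: complex^'p^'m) (B :: complex^'q^'m).
        is_dictionary (hconcat A B) \<and> coherence (hconcat A B) = d \<and>
        unit_columns A \<and> coherence A = a \<and>
        unit_columns B \<and> coherence B = b}"

text \<open>
  The \<open>n\<close> columns are selected by an index set \<open>S\<close>; since a matrix may have repeated columns,
  independence of the selected family is injectivity on \<open>S\<close> together with independence of its image.
\<close>

definition comb_of_indep_columns :: "complex^'m \<Rightarrow> nat \<Rightarrow> complex^'n^'m \<Rightarrow> bool" where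
  "comb_of_indep_columns v n A \<longleftrightarrow>
     (\<exists>S c. card S = n \<and>
            inj_on (\<lambda>j. column j A) S \<and>
            vec.independent ((\<lambda>j. column j A) ` S) \<and>
            v = (\<Sum>j\<in>S. c j *s column j A))"

end

theory Submission
  imports Defs
begin

text \<open>
  Write \<open>v = A x = B y\<close> with \<open>x\<close> and \<open>y\<close> supported on the selected columns. Pairing \<open>v\<close> with a selected
  column \<open>a\<^sub>i\<close> of \<open>A\<close> gives at least \<open>(1 + a) \<bar>x\<^sub>i\<bar> - a \<parallel>x\<parallel>\<^sub>1\<close> by the first representation and at most
  \<open>d \<parallel>y\<parallel>\<^sub>1\<close> by the second. Summing over \<open>i\<close> yields \<open>(1 - a (n\<^sub>a - 1)) \<parallel>x\<parallel>\<^sub>1 \<le> n\<^sub>a d \<parallel>y\<parallel>\<^sub>1\<close>. Multiply this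
  by its counterpart for \<open>B\<close> and cancel \<open>\<parallel>x\<parallel>\<^sub>1 \<parallel>y\<parallel>\<^sub>1 > 0\<close>.
\<close>

lemma herm_prod_commute: "herm_prod y x = cnj (herm_prod x y)"
  by (simp add: herm_prod_def mult.commute)

lemma herm_prod_self: "herm_prod x x = of_real ((norm x)\<^sup>2)"
proof -
  have "(norm x)\<^sup>2 = (\<Sum>i\<in>UNIV. (cmod (x $ i))\<^sup>2)"
    by (simp add: norm_vec_def L2_set_def sum_nonneg)
  then show ?thesis
    by (simp add: herm_prod_def complex_norm_square mult.commute del: of_real_power)
qed

lemma herm_prod_sum_scale_right:
  "herm_prod u (\<Sum>j\<in>S. c j *s w j) = (\<Sum>j\<in>S. c j * herm_prod u (w j))"
proof -
  have "herm_prod u (\<Sum>j\<in>S. c j *s w j) = (\<Sum>i\<in>UNIV. \<Sum>j\<in>S. c j * (cnj (u $ i) * w j $ i))"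
    by (simp add: herm_prod_def sum_distrib_left mult.left_commute)
  also have "\<dots> = (\<Sum>j\<in>S. c j * herm_prod u (w j))"
    by (subst sum.swap) (simp add: herm_prod_def sum_distrib_left)
  finally show ?thesis .
qed

text \<open>Two distinct indices exclude the one-column default value 0, and the set under
  \<open>Max\<close> is finite because it lies in the range of a function on a finite type.\<close>

lemma herm_prod_le_coherence:
  fixes A :: "complex^'n^'m"
  assumes "i \<noteq> j"
  shows "cmod (herm_prod (column i A) (column j A)) \<le> coherence A"
proof -
  have "card {i, j} \<le> CARD('n)"
    by (rule card_mono) auto
  then have "CARD('n) \<noteq> 1"
    using assms by simp
  moreover have "finite {cmod (herm_prod (column i A) (column j A)) | i j. i \<noteq> j}"
    by (rule finite_subset[of _ "range (\<lambda>(i, j). cmod (herm_prod (column i A) (column j A)))"]) auto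
  ultimately show ?thesis
    unfolding coherence_def using assms by (auto intro!: Max_ge)
qed

lemma column_hconcat_Inl: "column (Inl k) (hconcat A B) = column k A"
  and column_hconcat_Inr: "column (Inr l) (hconcat A B) = column l B"
  by (simp_all add: column_def hconcat_def)

lemma cross_coherence_le:
  "cmod (herm_prod (column k A) (column l B)) \<le> coherence (hconcat A B)"
  using herm_prod_le_coherence[of "Inl k" "Inr l" "hconcat A B"]
  by (simp add: column_hconcat_Inl column_hconcat_Inr)

text \<open>Membership in \<open>dictionary_class\<close> only yields some pair of blocks;
  injectivity of concatenation identifies that pair with the given \<open>A\<close> and
  \<open>B\<close>.\<close>

lemma hconcat_eq_iff: "hconcat A B = hconcat A' B' \<longleftrightarrow> A = A' \<and> B = B'"
proof
  assume eq: "hconcat A B = hconcat A' B'"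
  have "A $ i $ k = A' $ i $ k" for i k
    using arg_cong[OF eq, of "\<lambda>M. M $ i $ Inl k"] by (simp add: hconcat_def)
  moreover have "B $ i $ l = B' $ i $ l" for i l
    using arg_cong[OF eq, of "\<lambda>M. M $ i $ Inr l"] by (simp add: hconcat_def)
  ultimately show "A = A' \<and> B = B'"
    by (simp add: vec_eq_iff)
qed simp

text \<open>The bound \<open>K\<close> is kept abstract so that the estimate serves both
  sub-dictionaries: \<open>K\<close> becomes \<open>d\<close> times the l1 norm of the coefficients
  in the other representation.\<close>

lemma l1_norm_le_of_correlations:
  fixes A :: "complex^'n^'m"
  assumes unit: "unit_columns A"
    and v: "v = (\<Sum>j\<in>S. x j *s column j A)"
    and K: "\<And>i. cmod (herm_prod (column i A) v) \<le> K"
  shows "(1 - coherence A * (real (card S) - 1)) * (\<Sum>j\<in>S. cmod (x j)) \<le> real (card S) * K"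
proof -
  let ?a = "coherence A" and ?X = "\<Sum>j\<in>S. cmod (x j)"
  have pointwise: "(1 + ?a) * cmod (x i) - ?a * ?X \<le> K" if "i \<in> S" for i
  proof -
    let ?r = "\<Sum>j\<in>S - {i}. x j * herm_prod (column i A) (column j A)"
    have "herm_prod (column i A) (column i A) = 1"
      using unit by (simp add: herm_prod_self unit_columns_def)
    then have split: "herm_prod (column i A) v = x i + ?r"
      using that unfolding v herm_prod_sum_scale_right by (simp add: sum.remove)
    have "cmod ?r \<le> (\<Sum>j\<in>S - {i}. ?a * cmod (x j))"
      by (rule sum_norm_le)
        (auto simp: norm_mult mult.commute[of ?a] intro!: mult_left_mono herm_prod_le_coherence)
    also have "\<dots> = ?a * (?X - cmod (x i))"
      using that by (simp add: sum_distrib_left[symmetric] sum_diff1)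
    finally have "cmod ?r \<le> ?a * (?X - cmod (x i))" .
    moreover have "cmod (x i) - cmod ?r \<le> cmod (x i + ?r)"
      by (rule norm_diff_ineq)
    ultimately show ?thesis
      using K[of i] by (simp add: split algebra_simps)
  qed
  \<comment> \<open>With \<open>n = card S\<close>, the left side is
    \<open>(1 + ?a - n * ?a) * ?X\<close>, which is the source of the factor
    \<open>1 - ?a * (n - 1)\<close>.\<close>
  have "(\<Sum>i\<in>S. (1 + ?a) * cmod (x i) - ?a * ?X) \<le> (\<Sum>i\<in>S. K)"
    by (intro sum_mono pointwise)
  then show ?thesis
    by (simp add: sum_subtractf sum.distrib sum_distrib_left[symmetric] algebra_simps)
qed

lemma herm_prod_comb_le:
  assumes "\<And>j. cmod (herm_prod u (column j A)) \<le> d"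
  shows "cmod (herm_prod u (\<Sum>j\<in>S. y j *s column j A)) \<le> d * (\<Sum>j\<in>S. cmod (y j))"
  unfolding herm_prod_sum_scale_right sum_distrib_left
  by (rule sum_norm_le) (simp add: norm_mult mult.commute[of d] assms mult_left_mono)

text \<open>A vanishing l1 norm forces every coefficient, and hence \<open>v\<close>, to be
  zero.\<close>

lemma l1_norm_coeffs_pos:
  fixes v :: "complex^'m"
  assumes "v = (\<Sum>j\<in>S. x j *s w j)" "v \<noteq> 0" "finite S"
  shows "(\<Sum>j\<in>S. cmod (x j)) > 0"
proof (rule ccontr)
  assume "\<not> ?thesis"
  then have "(\<Sum>j\<in>S. cmod (x j)) = 0"
    using sum_nonneg[of S "\<lambda>j. cmod (x j)"] by simp
  then have "\<forall>j\<in>S. x j = 0"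
    using assms(3) by (simp add: sum_nonneg_eq_0_iff)
  then show False
    using assms by simp
qed

theorem lemma1:
  fixes A :: "complex^'p^'m" and B :: "complex^'q^'m" and D :: "complex^('p + 'q)^'m"
    and v :: "complex^'m" and a b d :: real and n_a n_b :: nat
  assumes "D = hconcat A B"
    and "D \<in> dictionary_class d a b"
    and "a \<le> b"
    and "v \<noteq> 0"
    and "comb_of_indep_columns v n_a A"
    and "comb_of_indep_columns v n_b B"
  shows "real n_a * real n_b
           \<ge> max 0 (1 - a * (real n_a - 1)) * max 0 (1 - b * (real n_b - 1)) / d\<^sup>2"
proof -
  have coh: "coherence (hconcat A B) = d" "coherence A = a" "coherence B = b"
    and unit: "unit_columns A" "unit_columns B"
    using assms(1,2) by (auto simp: dictionary_class_def hconcat_eq_iff)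
  obtain S x where S: "card S = n_a" and vA: "v = (\<Sum>j\<in>S. x j *s column j A)"
    using assms(5) by (auto simp: comb_of_indep_columns_def)
  obtain T y where T: "card T = n_b" and vB: "v = (\<Sum>j\<in>T. y j *s column j B)"
    using assms(6) by (auto simp: comb_of_indep_columns_def)
  define X where "X = (\<Sum>j\<in>S. cmod (x j))"
  define Y where "Y = (\<Sum>j\<in>T. cmod (y j))"
  define P where "P = max 0 (1 - a * (real n_a - 1))"
  define Q where "Q = max 0 (1 - b * (real n_b - 1))"
  have X: "X > 0" and Y: "Y > 0"
    using l1_norm_coeffs_pos[OF vA assms(4)] l1_norm_coeffs_pos[OF vB assms(4)]
    by (simp_all add: X_def Y_def)
  have cross: "cmod (herm_prod (column k A) (column l B)) \<le> d" for k l
    using cross_coherence_le coh(1) by metis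
  then have cross': "cmod (herm_prod (column l B) (column k A)) \<le> d" for k l
    by (subst herm_prod_commute) simp
  have d: "0 \<le> d"
    using cross norm_ge_zero order_trans by blast
  have "cmod (herm_prod (column i A) v) \<le> d * Y" for i
    unfolding vB Y_def by (intro herm_prod_comb_le cross)
  \<comment> \<open>If the bracket is negative, then \<open>P = 0\<close> and only nonnegativity of
    the right side is needed.\<close>
  from l1_norm_le_of_correlations[OF unit(1) vA this]
  have PX: "P * X \<le> real n_a * (d * Y)"
    using d Y by (auto simp: P_def X_def S coh max_def)
  have "cmod (herm_prod (column i B) v) \<le> d * X" for i
    unfolding vA X_def by (intro herm_prod_comb_le cross')
  from l1_norm_le_of_correlations[OF unit(2) vB this]
  have QY: "Q * Y \<le> real n_b * (d * X)"
    using d X by (auto simp: Q_def Y_def T coh max_def)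
  \<comment> \<open>Truncation at 0 makes \<open>Q * Y\<close> nonnegative, so the two inequalities
    may be multiplied.\<close>
  have "(P * X) * (Q * Y) \<le> (real n_a * (d * Y)) * (real n_b * (d * X))"
    using PX QY X Y d by (intro mult_mono[OF PX QY]) (simp_all add: Q_def)
  then have "(P * Q) * (X * Y) \<le> (real n_a * real n_b * d\<^sup>2) * (X * Y)"
    by (simp add: power2_eq_square mult_ac)
  then have "P * Q \<le> real n_a * real n_b * d\<^sup>2"
    using X Y by (simp add: mult_le_cancel_right not_less[symmetric])
  \<comment> \<open>For \<open>d = 0\<close> the quotient is 0 by the convention for division by
    zero.\<close>
  then have "P * Q / d\<^sup>2 \<le> real n_a * real n_b"
    by (cases "d = 0") (simp_all add: divide_le_eq)
  then show ?thesis
    by (simp add: P_def Q_def)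
qed

end
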